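(* Let $n \geq 1$ be an integer and let $s$ be an even integer with $0 < s \leq \lfloor 2n/3 \rfloor$. Then \[ \vartheta(H(n,s)_0) = |\mathbb{H}^n_s|\,\frac{M_Q^n(s)}{M_Q^n(s) - 1}. \]
   Context: Hamming cube. $\mathbb{H}^n = \{0,1\}^n$ with the Hamming distance $d(x,y)$ (number of positions in which $x$ and $y$ differ). The weight of $x\in\mathbb{H}^n$ is the number of 1s in it, and $\mathbb{H}^n_s$ is the set of words of weight $s$. Three distinct points $x_1,x_2,x_3 \in \mathbb{H}^n$ form an $s$-triangle if $d(x_i,x_j) = s$ for all $i \neq j$. $H(n,s)$ is the $3$-uniform hypergraph with vertex set $\mathbb{H}^n$ whose edges are all $s$-triangles. $H(n,s)_0$ is the link (defined below) of the all-zero word $0$ in $H(n,s)$; for $s$ as in the claim it is the graph with vertex set $\mathbb{H}^n_s$ in which two words are adjacent if they are at distance $s$. Hahn polynomials. $Q^{n,s}_k$ is the Hahn polynomial of degree $k$, normalized so that $Q^{n,s}_k(0)=1$; for an integer $0 \leq t \leq s$ these polynomials are given by the formula \[ Q^{n,s}_k(t) = \sum_{i=0}^k (-1)^i \binom{s}{i}^{-1}\binom{n-s}{i}^{-1}\binom{k}{i}\binom{n+1-k}{i}\binom{t}{i}, \] and $M_Q^n(s) = \min\{ Q^{n,s}_k(s/2) : k = 0,\dots,s\}$. Theta number. For an integer $r \geq 1$, an $r$-uniform hypergraph $H=(V,E)$ consists of a finite set $V$ and a set $E$ of $r$-element subsets of $V$ (graphs are the case $r=2$). A set $I \subseteq V$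 is independent if it contains no edge. $\mathrm{IND}(H) = \mathrm{conv}\{\chi_I \in \mathbb{R}^V : I \subseteq V \text{ independent}\}$, where $\chi_I$ is the characteristic function of $I$. For $r \geq 2$ and $x \in V$, the link of $x$ in $H$ is the $(r-1)$-uniform hypergraph $H_x$ with vertex set $V_x = \{ y \in V \setminus\{x\} : \text{there is } e \in E \text{ containing } x \text{ and } y\}$, in which an $(r-1)$-subset $e$ of $V_x$ is an edge if and only if $e \cup \{x\} \in E$. For $A \in \mathbb{R}^{V\times V}$, $A_x$ is the row indexed by $x$; $f[U]$ is the restriction of $f$ to $U$. Positive semidefinite matrices are always symmetric. For a symmetric matrix $A$ with diagonal $a$, write $R(A) = \begin{pmatrix} 1 & a^{\mathsf T} \\ a & A\end{pmatrix}$. The theta body is defined recursively: for $r = 1$, $\mathrm{TH}(H) = \mathrm{IND}(H)$; for $r \geq 2$, $\mathrm{TH}(H)$ is the set of all $f \in \mathbb{R}^V$ for which there is $F \in \mathbb{R}^{V \times V}$ such that $f = \mathrm{diag}\,F$, $F_x[V_x] \in F(x,x)\,\mathrm{TH}(H_x)$ for every $x \in V$ (no constraint on row $F_x$ if the link $H_x$ is empty), and $R(F)$ is positive semidefinite. (For a graph this is the usual theta body.) $\vartheta(H) = \max\{ \sum_{x \in V} f(x) : f \in \mathrm{TH}(H)\}$.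
   Formalization: The minimum M_Q^n(s) is taken only over those k in 0,…,s with k ≤ n−s, because for s > n/2 the formula for Q_k^{n,s} with k > n−s divides by zero (ignoring those terms gives the wrong value at n=3, s=2); for s ≤ n/2 nothing changes. *)

theory Defs
  imports Complex_Main "HOL-Library.FuncSet" "HOL-Library.Indicator_Function"
begin

section \<open>Hypergraphs\<close>

record 'a hypergraph =
  hverts :: "'a set"
  hedges :: "'a set set"

definition uniform :: "nat \<Rightarrow> 'a hypergraph \<Rightarrow> bool" where
  "uniform r H \<longleftrightarrow> finite (hverts H) \<and> (\<forall>e\<in>hedges H. e \<subseteq> hverts H \<and> finite e \<and> card e = r)"

definition independent_in :: "'a hypergraph \<Rightarrow> 'a set \<Rightarrow> bool" where
  "independent_in H I \<longleftrightarrow> I \<subseteq> hverts H \<and> (\<forall>e\<in>hedges H. \<not> e \<subseteq> I)"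

definition hyp_link :: "'a hypergraph \<Rightarrow> 'a \<Rightarrow> 'a hypergraph" where
  "hyp_link H x =
    (let Vx = {y \<in> hverts H - {x}. \<exists>e\<in>hedges H. x \<in> e \<and> y \<in> e}
     in \<lparr>hverts = Vx, hedges = {e. e \<subseteq> Vx \<and> e \<union> {x} \<in> hedges H}\<rparr>)"

text \<open>The cardinality requirement on link edges is automatic, since \<open>x\<close> is not a vertex of the
  link.\<close>

lemma uniform_hyp_link:
  assumes "uniform (Suc r) H"
  shows "uniform r (hyp_link H x)"
proof -
  have "finite e \<and> card e = r" if "e \<union> {x} \<in> hedges H" "x \<notin> e" for e
  proof -
    have "finite (insert x e)" "card (insert x e) = Suc r"
      using assms that(1) by (auto simp: uniform_def)
    with that(2) show ?thesis by simp
  qed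
  then show ?thesis
    using assms by (auto simp: uniform_def hyp_link_def Let_def)
qed


section \<open>The theta body and the theta number\<close>

text \<open>Vectors in \<open>\<real>\<^sup>V\<close> are functions in \<^term>\<open>extensional V\<close>, so that they are determined by their
  values on \<open>V\<close>. Matrices are functions of two arguments, of which only the values on the relevant
  index set are ever used.\<close>

text \<open>Convex hull in \<open>\<real>\<^sup>V\<close>; the function type carries no vector space instance in the library.\<close>

definition conv_on :: "'a set \<Rightarrow> ('a \<Rightarrow> real) set \<Rightarrow> ('a \<Rightarrow> real) set" where
  "conv_on V S = {f. \<exists>T c. finite T \<and> T \<subseteq> S \<and> (\<forall>g\<in>T. 0 \<le> c g) \<and> (\<Sum>g\<in>T. c g) = 1 \<and>
                           f = (\<lambda>v\<in>V. \<Sum>g\<in>T. c g * g v)}"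

definition IND :: "'a hypergraph \<Rightarrow> ('a \<Rightarrow> real) set" where
  "IND H = conv_on (hverts H) {restrict (indicator I) (hverts H) | I. independent_in H I}"

definition psd_on :: "'i set \<Rightarrow> ('i \<Rightarrow> 'i \<Rightarrow> real) \<Rightarrow> bool" where
  "psd_on S A \<longleftrightarrow> (\<forall>i\<in>S. \<forall>j\<in>S. A i j = A j i) \<and>
                  (\<forall>c. 0 \<le> (\<Sum>i\<in>S. \<Sum>j\<in>S. c i * A i j * c j))"

text \<open>The bordered matrix \<open>R(A)\<close>; the extra row and column have index \<^const>\<open>None\<close>.\<close>

fun bordered :: "('a \<Rightarrow> 'a \<Rightarrow> real) \<Rightarrow> 'a option \<Rightarrow> 'a option \<Rightarrow> real" where
  "bordered A None None = 1"
| "bordered A None (Some y) = A y y"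
| "bordered A (Some x) None = A x x"
| "bordered A (Some x) (Some y) = A x y"

text \<open>The first argument is the uniformity of the hypergraph; it is passed explicitly because a
  hypergraph without edges does not determine it. Uniformity \<open>0\<close> does not occur and is left
  unspecified.\<close>

fun theta_body :: "nat \<Rightarrow> 'a hypergraph \<Rightarrow> ('a \<Rightarrow> real) set" where
  "theta_body (Suc 0) H = IND H"
| "theta_body (Suc (Suc r)) H =
    {f \<in> extensional (hverts H). \<exists>F.
       (\<forall>x\<in>hverts H. f x = F x x) \<and>
       (\<forall>x\<in>hverts H. let Vx = hverts (hyp_link H x) in Vx \<noteq> {} \<longrightarrow>
          restrict (F x) Vx
            \<in> (\<lambda>g. \<lambda>y\<in>Vx. F x x * g y) ` theta_body (Suc r) (hyp_link H x)) \<and>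
       psd_on (insert None (Some ` hverts H)) (bordered F)}"

text \<open>\<^const>\<open>Greatest\<close> rather than \<^const>\<open>Sup\<close>: the theta number is an attained maximum.\<close>

definition theta_number :: "nat \<Rightarrow> 'a hypergraph \<Rightarrow> real" where
  "theta_number r H = (GREATEST t. \<exists>f\<in>theta_body r H. t = (\<Sum>x\<in>hverts H. f x))"


section \<open>The Hamming cube and its triangles\<close>

definition cube :: "nat \<Rightarrow> bool list set" where
  "cube n = {x. length x = n}"

definition hamming_dist :: "bool list \<Rightarrow> bool list \<Rightarrow> nat" where
  "hamming_dist x y = card {i. i < length x \<and> x ! i \<noteq> y ! i}"

definition weight :: "bool list \<Rightarrow> nat" where
  "weight x = count_list x True"

definition weight_words :: "nat \<Rightarrow> nat \<Rightarrow> bool list set" where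
  "weight_words n s = {x \<in> cube n. weight x = s}"

definition zero_word :: "nat \<Rightarrow> bool list" where
  "zero_word n = replicate n False"

definition triangle_hypergraph :: "nat \<Rightarrow> nat \<Rightarrow> bool list hypergraph" where
  "triangle_hypergraph n s =
    \<lparr>hverts = cube n,
     hedges = {e. e \<subseteq> cube n \<and> card e = 3 \<and> (\<forall>x\<in>e. \<forall>y\<in>e. x \<noteq> y \<longrightarrow> hamming_dist x y = s)}\<rparr>"

lemma uniform_triangle_hypergraph: "uniform 3 (triangle_hypergraph n s)"
proof -
  have "finite (cube n)"
    using finite_lists_length_eq[of "UNIV :: bool set" n] by (simp add: cube_def)
  then show ?thesis
    by (auto simp: uniform_def triangle_hypergraph_def intro: finite_subset)
qed


section \<open>Hahn polynomials\<close>

text \<open>The value at \<open>0\<close> is \<open>1\<close>, and at an integer \<open>t\<close> the generalized binomial coefficient is the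
  ordinary one. The formula makes sense for \<open>k \<le> min s (n - s)\<close>; for larger \<open>k\<close> it contains the
  inverse of a binomial coefficient that is zero.\<close>

definition hahn :: "nat \<Rightarrow> nat \<Rightarrow> nat \<Rightarrow> real \<Rightarrow> real" where
  "hahn n s k t =
    (\<Sum>i=0..k. (- 1) ^ i * inverse (real (s choose i)) * inverse (real ((n - s) choose i))
               * real (k choose i) * real ((n + 1 - k) choose i) * (t gchoose i))"

text \<open>The minimum over those \<open>k = 0, \<dots>, s\<close> for which the Hahn polynomial of degree \<open>k\<close> exists, that
  is, over \<open>k \<le> min s (n - s)\<close>. The bound \<open>n - s\<close> is void when \<open>s \<le> n / 2\<close>; when \<open>s > n / 2\<close> it
  discards the degrees for which the formula divides by zero. It cannot be dropped by means of
  \<open>inverse 0 = 0\<close>: for \<open>n = 3\<close> and \<open>s = 2\<close> this would add the value \<open>-1\<close> at \<open>k = 2\<close>, while the smallest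
  value at \<open>k \<le> 1\<close> is \<open>-1/2\<close>.\<close>

definition M_Q :: "nat \<Rightarrow> nat \<Rightarrow> real" where
  "M_Q n s = Min {hahn n s k (real s / 2) | k. k \<in> {0..s} \<and> k \<le> n - s}"

end

theory Submission
  imports Defs
begin

text \<open>
  The link of the zero word is the graph on the words of weight \<open>s\<close> in which two words are adjacent if
  their supports \<open>X\<close>, \<open>Y\<close> satisfy \<open>|X - Y| = s/2\<close>. Each vertex of a graph has a link whose vertices
  are all edges, so the only independent set of the link is empty, and the theta body of the graph
  consists of the diagonals of the matrices \<open>F\<close> that vanish on the edges and have \<open>R(F)\<close> positive
  semidefinite (\<open>theta_body_graph\<close>).

  The theta number is then governed by the spectrum of the adjacency matrix. Write
  \<open>K\<^sub>k(X, Y) = Q\<^sub>k(|X - Y|)\<close> for \<open>k \<le> m = min s (n - s)\<close>. The Hahn polynomials satisfy a second-order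
  difference equation (\<open>johnson_diff_hahn\<close>), which says precisely that the columns of \<open>K\<^sub>k\<close> are
  eigenvectors of the Johnson graph (words related by moving one element of the support), with
  eigenvalues that differ for different \<open>k\<close>. That graph is undirected, so \<open>K\<^sub>j K\<^sub>k = 0\<close> for \<open>j \<noteq> k\<close>
  (\<open>hahn_kernels_orthogonal\<close>). As \<open>Q\<^sub>k\<close> has degree \<open>k\<close>, every function on \<open>{0,\<dots>,m}\<close> is a combination
  of \<open>Q\<^sub>0,\<dots>,Q\<^sub>m\<close> (\<open>hahn_expansion\<close>); hence the identity matrix \<open>I\<close> and the adjacency matrix \<open>A\<close> lie in
  the span of the \<open>K\<^sub>k\<close>. Multiplying \<open>I = \<Sum>k. w\<^sub>k K\<^sub>k\<close> by \<open>K\<^sub>k\<close> gives \<open>K\<^sub>k = w\<^sub>k K\<^sub>k\<^sup>2\<close>, so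
  \<open>w\<^sub>k > 0\<close> and the \<open>w\<^sub>k K\<^sub>k\<close> are orthogonal projections; comparing diagonals of \<open>A K\<^sub>k\<close> shows that the
  eigenvalue of \<open>A\<close> on the range of \<open>K\<^sub>k\<close> is \<open>d Q\<^sub>k(s/2)\<close>, where \<open>d\<close> is the degree of the graph
  (\<open>spectral_decomposition\<close>). The smallest eigenvalue is therefore \<open>d M\<close> with \<open>M = M\<^sub>Q\<close>, and
  \<open>M < 0\<close> because \<open>A\<close> has trace zero.

  What remains is the Hoffman-Lovasz argument. Let \<open>N\<close> be the number of vertices. For feasible \<open>F\<close> with
  trace \<open>S\<close>, positivity of \<open>R(F)\<close> gives that the sum of the entries of \<open>F\<close> is at least \<open>S\<^sup>2\<close>, and
  pairing \<open>F\<close> with the positive semidefinite matrix \<open>A/d - M I - (1 - M)/N J\<close>, \<open>J\<close> being the all-ones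
  matrix, yields \<open>(1 - M) S\<^sup>2/N \<le> - M S\<close> (\<open>trace_upper_bound\<close>). If \<open>Q\<^sub>k(s/2) = M\<close>, a suitable
  combination of \<open>J\<close> and \<open>K\<^sub>k\<close> attains this bound (\<open>trace_bound_attained\<close>).
\<close>

section \<open>The difference equation of the Hahn polynomials\<close>

text \<open>The coefficients of the Hahn polynomial in the Newton basis \<open>t gchoose i\<close>.\<close>

definition hahn_coeff :: "nat \<Rightarrow> nat \<Rightarrow> nat \<Rightarrow> nat \<Rightarrow> real" where
  "hahn_coeff n s k i = (- 1) ^ i * inverse (real (s choose i)) * inverse (real ((n - s) choose i))
     * real (k choose i) * real ((n + 1 - k) choose i)"

lemma hahn_eq_sum_hahn_coeff: "hahn n s k t = (\<Sum>i\<le>k. hahn_coeff n s k i * (t gchoose i))"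
  by (simp add: hahn_def hahn_coeff_def atLeast0AtMost)

lemma hahn_at_0 [simp]: "hahn n s k 0 = 1"
proof -
  have "hahn n s k 0 = (\<Sum>i\<le>k. if i = 0 then 1 else 0)"
    unfolding hahn_eq_sum_hahn_coeff
  proof (rule sum.cong[OF refl])
    fix i
    show "hahn_coeff n s k i * (0 gchoose i) = (if i = 0 then 1 else 0)"
      by (cases i) (simp_all add: hahn_coeff_def)
  qed
  then show ?thesis by simp
qed

lemma hahn_degree_0 [simp]: "hahn n s 0 t = 1"
  by (simp add: hahn_def)

lemma of_nat_choose_Suc:
  "real (a choose Suc i) * (1 + real i) = real (a choose i) * (real a - real i)"
  using gbinomial_mult_1[of "real a" i] by (simp add: binomial_gbinomial algebra_simps)

text \<open>This ratio of consecutive coefficients is what comparing coefficients in the difference equation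
  calls for. The bounds on \<open>k\<close> keep the inverted binomial coefficients nonzero.\<close>

lemma hahn_coeff_Suc:
  assumes "s \<le> n" "k \<le> s" "k \<le> n - s" "i \<le> k"
  shows "hahn_coeff n s k (Suc i) * ((real s - real i) * (real (n - s) - real i))
         = - ((real k - real i) * (real n + 1 - real k - real i)) * hahn_coeff n s k i"
proof (cases "i = k")
  case True
  then show ?thesis by (simp add: hahn_coeff_def)
next
  case False
  with assms have i: "i < k" "i < s" "i < n - s" by auto
  have pos: "real (a choose i) > 0" "real (a choose Suc i) > 0" if "i < a" for a
    using that by simp_all
  have quot: "inverse (real (a choose Suc i)) * (real a - real i)
      = (1 + real i) * inverse (real (a choose i))" if "i < a" for a
    using pos[OF that] of_nat_choose_Suc[of a i] by (simp add: field_simps)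
  have kk: "real (n + 1 - k) = real n + 1 - real k" using assms by simp
  have "hahn_coeff n s k (Suc i) * ((real s - real i) * (real (n - s) - real i))
      = - ((- 1) ^ i) * (inverse (real (s choose Suc i)) * (real s - real i))
         * (inverse (real ((n - s) choose Suc i)) * (real (n - s) - real i))
         * real (k choose Suc i) * real ((n + 1 - k) choose Suc i)"
    by (simp add: hahn_coeff_def)
  also have "\<dots> = - ((- 1) ^ i) * inverse (real (s choose i)) * inverse (real ((n - s) choose i))
         * (real (k choose Suc i) * (1 + real i)) * (real ((n + 1 - k) choose Suc i) * (1 + real i))"
    unfolding quot[OF i(2)] quot[OF i(3)] by (simp only: mult_ac)
  also have "\<dots> = - ((real k - real i) * (real n + 1 - real k - real i)) * hahn_coeff n s k i"
    unfolding of_nat_choose_Suc kk by (simp add: hahn_coeff_def)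
  finally show ?thesis .
qed

text \<open>For integers \<open>a\<close>, \<open>b\<close>, let \<open>|X| = a\<close>, let the complement of \<open>X\<close> have \<open>b\<close> elements, let \<open>|Y| = a\<close>
  and \<open>|X - Y| = t\<close>. Among the sets that arise from \<open>X\<close> by exchanging one element with the complement,
  \<open>(a - t)(b - t)\<close> have distance \<open>t + 1\<close> to \<open>Y\<close> and \<open>t\<^sup>2\<close> have distance \<open>t - 1\<close>. The operator is thus
  the radial part of the adjacency matrix of the Johnson graph minus its degree \<open>a b\<close>.\<close>

definition johnson_diff :: "real \<Rightarrow> real \<Rightarrow> (real \<Rightarrow> real) \<Rightarrow> real \<Rightarrow> real" where
  "johnson_diff a b h t = (a - t) * (b - t) * (h (t + 1) - h t) + t\<^sup>2 * (h (t - 1) - h t)"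

lemma johnson_diff_sum:
  "johnson_diff a b (\<lambda>t. \<Sum>i\<in>I. c i * f i t) t = (\<Sum>i\<in>I. c i * johnson_diff a b (f i) t)"
  unfolding johnson_diff_def
  by (simp add: sum_subtractf[symmetric] sum_distrib_left sum.distrib[symmetric] algebra_simps)

text \<open>In the Newton basis the operator is bidiagonal, which turns its eigenvalue equation into a
  two-term recurrence for the coefficients.\<close>

lemma johnson_diff_gbinomial:
  "johnson_diff a b (\<lambda>t. t gchoose Suc j) t
   = (a - real j) * (b - real j) * (t gchoose j) - (real j + 1) * (a + b - real j) * (t gchoose Suc j)"
proof -
  define B0 B1 B2 where "B0 = t gchoose j" and "B1 = t gchoose Suc j" and "B2 = t gchoose Suc (Suc j)"
  have up: "((t + 1) gchoose Suc j) - (t gchoose Suc j) = B0"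
    by (simp add: gbinomial_Suc_Suc B0_def)
  have down: "((t - 1) gchoose Suc j) - (t gchoose Suc j) = - ((t - 1) gchoose j)"
    using gbinomial_Suc_Suc[of "t - 1" j] by simp
  have absorb: "t * ((t - 1) gchoose j) = (real j + 1) * B1"
    using Suc_times_gbinomial[of j "t - 1"] by (simp add: B1_def add.commute)
  have e0: "t * B0 = real j * B0 + (real j + 1) * B1"
    using gbinomial_mult_1[of t j] by (simp add: B0_def B1_def algebra_simps)
  have "johnson_diff a b (\<lambda>t. t gchoose Suc j) t = (a - t) * (b - t) * B0 - t * (t * ((t - 1) gchoose j))"
    unfolding johnson_diff_def up down by (simp add: power2_eq_square algebra_simps)
  also have "\<dots> = (a - t) * (b - t) * B0 - t * ((real j + 1) * B1)"
    by (simp only: absorb)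
  also have "\<dots> = a * b * B0 - (a + b) * (t * B0) + t * (t * B0 - (real j + 1) * B1)"
    by (simp add: algebra_simps)
  also have "t * B0 - (real j + 1) * B1 = real j * B0" using e0 by simp
  also have "t * (real j * B0) = real j * (t * B0)" by simp
  also have "a * b * B0 - (a + b) * (t * B0) + real j * (t * B0)
      = (a - real j) * (b - real j) * B0 - (real j + 1) * (a + b - real j) * B1"
    unfolding e0 by (simp add: algebra_simps)
  finally show ?thesis by (simp add: B0_def B1_def)
qed

text \<open>In the coefficient of \<open>t gchoose j\<close>, up to a common sign, the recurrence contributes \<open>(k - j)(n + 1 - k - j)\<close> and
  the diagonal part \<open>j (n + 1 - j)\<close>; their sum \<open>k (n + 1 - k)\<close> is independent of \<open>j\<close>.\<close>

lemma johnson_diff_hahn: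
  assumes "s \<le> n" "k \<le> s" "k \<le> n - s"
  shows "johnson_diff (real s) (real (n - s)) (hahn n s k) t
         = - (real k * (real n + 1 - real k)) * hahn n s k t"
proof -
  define c where "c = hahn_coeff n s k"
  define B where "B = (\<lambda>i. t gchoose i)"
  define u where "u = (\<lambda>i. (real s - real i) * (real (n - s) - real i))"
  have ns: "real s + real (n - s) = real n" using assms by simp
  have h: "hahn n s k = (\<lambda>t. \<Sum>i\<le>k. c i * (t gchoose i))"
    by (simp add: fun_eq_iff hahn_eq_sum_hahn_coeff c_def)
  have last: "c (Suc k) = 0" by (simp add: c_def hahn_coeff_def)
  have "johnson_diff (real s) (real (n - s)) (hahn n s k) t
      = (\<Sum>i\<le>k. c i * johnson_diff (real s) (real (n - s)) (\<lambda>t. t gchoose i) t)"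
    unfolding h by (rule johnson_diff_sum)
  \<comment> \<open>A vanishing extra term makes the index shift below come out evenly.\<close>
  also have "\<dots> = (\<Sum>i\<le>Suc k. c i * johnson_diff (real s) (real (n - s)) (\<lambda>t. t gchoose i) t)"
    using last by simp
  also have "\<dots> = (\<Sum>j\<le>k. c (Suc j) * johnson_diff (real s) (real (n - s)) (\<lambda>t. t gchoose Suc j) t)"
    by (subst sum.atMost_Suc_shift) (simp add: johnson_diff_def)
  also have "\<dots> = (\<Sum>j\<le>k. c (Suc j) * u j * B j)
      - (\<Sum>j\<le>k. real (Suc j) * (real n + 1 - real (Suc j)) * c (Suc j) * B (Suc j))"
    unfolding johnson_diff_gbinomial ns sum_subtractf[symmetric] u_def B_def
    by (intro sum.cong refl) (simp add: algebra_simps)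
  also have "(\<Sum>j\<le>k. real (Suc j) * (real n + 1 - real (Suc j)) * c (Suc j) * B (Suc j))
      = (\<Sum>j\<le>Suc k. real j * (real n + 1 - real j) * c j * B j)"
    by (subst sum.atMost_Suc_shift) simp
  also have "\<dots> = (\<Sum>j\<le>k. real j * (real n + 1 - real j) * c j * B j)"
    using last by simp
  also have "(\<Sum>j\<le>k. c (Suc j) * u j * B j)
      = (\<Sum>j\<le>k. - ((real k - real j) * (real n + 1 - real k - real j)) * c j * B j)"
    using hahn_coeff_Suc[OF assms] by (intro sum.cong refl) (simp add: c_def u_def)
  also have "\<dots> - (\<Sum>j\<le>k. real j * (real n + 1 - real j) * c j * B j)
      = - (real k * (real n + 1 - real k)) * (\<Sum>j\<le>k. c j * B j)"
    unfolding sum_subtractf[symmetric] sum_distrib_left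
    by (intro sum.cong refl) (simp add: algebra_simps)
  finally show ?thesis by (simp add: h B_def)
qed

section \<open>Expansions in Hahn polynomials\<close>

text \<open>Interpolation in the nodes \<open>0,\<dots>,m\<close>: a new node is accommodated by the coefficient of
  \<open>t choose Suc m\<close>, which vanishes at all earlier nodes and is \<open>1\<close> at the new one.\<close>

lemma newton_expansion:
  "\<exists>a. \<forall>t\<le>m. (g :: nat \<Rightarrow> real) t = (\<Sum>i\<le>m. a i * real (t choose i))"
proof (induction m)
  case 0
  show ?case by (rule exI[of _ g]) simp
next
  case (Suc m)
  then obtain a where a: "\<And>t. t \<le> m \<Longrightarrow> g t = (\<Sum>i\<le>m. a i * real (t choose i))" by blast
  define a' where "a' = a(Suc m := g (Suc m) - (\<Sum>i\<le>m. a i * real (Suc m choose i)))"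
  have eq: "(\<Sum>i\<le>m. a' i * real (t choose i)) = (\<Sum>i\<le>m. a i * real (t choose i))" for t
    by (intro sum.cong refl) (simp add: a'_def)
  have "g t = (\<Sum>i\<le>Suc m. a' i * real (t choose i))" if "t \<le> Suc m" for t
  proof (cases "t = Suc m")
    case True
    have "(\<Sum>i\<le>Suc m. a' i * real (t choose i)) = (\<Sum>i\<le>m. a i * real (t choose i)) + a' (Suc m)"
      using True by (simp only: sum.atMost_Suc eq) simp
    then show ?thesis using True by (simp only: a'_def fun_upd_same)
  next
    case False
    with that have "t \<le> m" by simp
    then show ?thesis using a[of t] by (simp only: sum.atMost_Suc eq) simp
  qed
  then show ?case by blast
qed

text \<open>The Hahn polynomials are triangular in the Newton basis. The leading coefficient of \<open>Q\<^sub>k\<close> contains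
  \<open>(n + 1 - k) choose k\<close>, which is nonzero because \<open>k \<le> s\<close> and \<open>k \<le> n - s\<close> give \<open>2 k \<le> n\<close>.\<close>

lemma hahn_expansion_of_polynomial:
  assumes "s \<le> n" "m \<le> s" "m \<le> n - s"
  shows "\<exists>b. \<forall>t. (\<Sum>i\<le>m. a i * (t gchoose i)) = (\<Sum>k\<le>m. b k * hahn n s k t)"
  using assms(2,3)
proof (induction m arbitrary: a)
  case 0
  show ?case by (rule exI[of _ a]) simp
next
  case (Suc m)
  define c where "c = hahn_coeff n s (Suc m)"
  have nz: "c (Suc m) \<noteq> 0"
    using Suc.prems assms(1) by (simp add: c_def hahn_coeff_def)
  define r where "r = a (Suc m) / c (Suc m)"
  obtain b where b: "\<And>t. (\<Sum>i\<le>m. (a i - r * c i) * (t gchoose i)) = (\<Sum>k\<le>m. b k * hahn n s k t)"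
    using Suc.IH[of "\<lambda>i. a i - r * c i"] Suc.prems by auto
  have "(\<Sum>i\<le>Suc m. a i * (t gchoose i)) = (\<Sum>k\<le>Suc m. (b(Suc m := r)) k * hahn n s k t)" for t
  proof -
    have "r * hahn n s (Suc m) t = (\<Sum>i\<le>m. r * c i * (t gchoose i)) + a (Suc m) * (t gchoose Suc m)"
      using nz by (simp add: hahn_eq_sum_hahn_coeff c_def[symmetric] r_def sum_distrib_left
          distrib_left mult.assoc)
    moreover have "(\<Sum>i\<le>m. a i * (t gchoose i))
        = (\<Sum>i\<le>m. (a i - r * c i) * (t gchoose i)) + (\<Sum>i\<le>m. r * c i * (t gchoose i))"
      by (simp add: sum.distrib[symmetric] algebra_simps)
    ultimately show ?thesis
      by (simp add: b)
  qed
  then show ?case by blast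
qed

lemma hahn_expansion:
  assumes "s \<le> n" "m \<le> s" "m \<le> n - s"
  shows "\<exists>b. \<forall>t\<le>m. (g :: nat \<Rightarrow> real) t = (\<Sum>k\<le>m. b k * hahn n s k (real t))"
proof -
  obtain a where a: "\<And>t. t \<le> m \<Longrightarrow> g t = (\<Sum>i\<le>m. a i * real (t choose i))"
    using newton_expansion[where g = g and m = m] by blast
  obtain b where "\<And>t. (\<Sum>i\<le>m. a i * (t gchoose i)) = (\<Sum>k\<le>m. b k * hahn n s k t)"
    using hahn_expansion_of_polynomial[OF assms, where a = a] by blast
  with a show ?thesis by (metis (no_types, lifting) binomial_gbinomial sum.cong)
qed

section \<open>Eigenkernels of the Johnson graph\<close>

definition level :: "nat \<Rightarrow> nat \<Rightarrow> nat set set" where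
  "level n s = {X. X \<subseteq> {..<n} \<and> card X = s}"

lemma finite_level: "finite (level n s)"
  unfolding level_def by (rule finite_subset[of _ "Pow {..<n}"]) auto

lemma level_card:
  assumes "X \<in> level n s" "Y \<in> level n s"
  shows "finite X" "finite Y" "s \<le> n"
    and "card (Y - X) = card (X - Y)" "card (X - Y) \<le> s" "card (X - Y) \<le> n - s"
    and "real (card (X \<inter> Y)) = real s - real (card (X - Y))"
    and "real (card ({..<n} - X - Y)) = real (n - s) - real (card (X - Y))"
proof -
  from assms have X: "X \<subseteq> {..<n}" "card X = s" and Y: "Y \<subseteq> {..<n}" "card Y = s"
    by (auto simp: level_def)
  show fin: "finite X" "finite Y" using X Y finite_subset by blast+
  show sn: "s \<le> n" using card_mono[OF _ X(1)] X(2) by simp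
  have 1: "card (X \<inter> Y) + card (X - Y) = s"
    using card_Int_Diff[OF fin(1), of Y] X by simp
  have 2: "card (Y \<inter> X) + card (Y - X) = s"
    using card_Int_Diff[OF fin(2), of X] Y by simp
  show yx: "card (Y - X) = card (X - Y)" using 1 2 by (simp add: Int_commute)
  show "card (X - Y) \<le> s" using 1 by simp
  have co: "card ({..<n} - X) = n - s" using X fin by (simp add: card_Diff_subset)
  have "card (({..<n} - X) \<inter> Y) + card ({..<n} - X - Y) = n - s"
    using card_Int_Diff[of "{..<n} - X" Y] co by simp
  moreover have "({..<n} - X) \<inter> Y = Y - X" using Y by auto
  ultimately have 3: "card (X - Y) + card ({..<n} - X - Y) = n - s" using yx by simp
  show "card (X - Y) \<le> n - s" using 3 by simp
  show "real (card (X \<inter> Y)) = real s - real (card (X - Y))" using 1 by simp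
  show "real (card ({..<n} - X - Y)) = real (n - s) - real (card (X - Y))" using 3 by simp
qed

text \<open>The adjacency operator of the Johnson graph, written as a sum over exchanges.\<close>

definition swap_sum :: "nat \<Rightarrow> (nat set \<Rightarrow> real) \<Rightarrow> nat set \<Rightarrow> real" where
  "swap_sum n g X = (\<Sum>a\<in>X. \<Sum>b\<in>{..<n} - X. g (insert b (X - {a})))"

text \<open>Every exchange can be undone: \<open>(X, a, b)\<close> corresponds to the exchange \<open>(X - {a} \<union> {b}, b, a)\<close>.\<close>

lemma swap_sum_self_adjoint:
  "(\<Sum>X\<in>level n s. f X * swap_sum n g X) = (\<Sum>X\<in>level n s. swap_sum n f X * g X)"
proof -
  let ?T = "SIGMA X:level n s. X \<times> ({..<n} - X)"
  have fin: "finite X" if "X \<in> level n s" for X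
    using level_card(1)[OF that that] .
  have swapped: "insert b (X - {a}) \<in> level n s" if "X \<in> level n s" "a \<in> X" "b \<in> {..<n} - X" for X a b
  proof -
    have "card X > 0" using that fin[OF that(1)] by (auto simp: card_gt_0_iff)
    then show ?thesis using that fin[OF that(1)] by (auto simp: level_def)
  qed
  have L: "(\<Sum>X\<in>level n s. f X * swap_sum n g X)
      = (\<Sum>(X, a, b)\<in>?T. f X * g (insert b (X - {a})))"
    by (simp add: swap_sum_def sum_distrib_left sum.cartesian_product
        sum.Sigma finite_level fin split_def)
  have R: "(\<Sum>X\<in>level n s. swap_sum n f X * g X)
      = (\<Sum>(X, a, b)\<in>?T. f (insert b (X - {a})) * g X)"
    by (simp add: swap_sum_def sum_distrib_right sum.cartesian_product
        sum.Sigma finite_level fin split_def)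
  show ?thesis
    unfolding L R
    by (rule sum.reindex_bij_witness[where i = "\<lambda>(X, a, b). (insert b (X - {a}), b, a)"
          and j = "\<lambda>(X, a, b). (insert b (X - {a}), b, a)"])
      (auto intro!: swapped simp: insert_absorb, (auto simp: level_def)?)
qed

text \<open>Exchanging \<open>a \<in> X\<close> for \<open>b \<notin> X\<close> changes \<open>|X - Y|\<close> only if exactly one of \<open>a\<close>, \<open>b\<close> lies in \<open>Y\<close>: it
  grows if this is \<open>a\<close> and shrinks if it is \<open>b\<close>. Counting such pairs yields the coefficients of
  \<open>johnson_diff\<close>.\<close>

lemma swap_sum_distance:
  assumes "X \<in> level n s" "Y \<in> level n s"
  shows "swap_sum n (\<lambda>Z. h (real (card (Z - Y)))) X
         = real s * real (n - s) * h (real (card (X - Y)))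
           + johnson_diff (real s) (real (n - s)) h (real (card (X - Y)))"
proof -
  note c = level_card[OF assms]
  define t where "t = card (X - Y)"
  define D E where "D = h (real t + 1) - h (real t)" and "E = h (real t - 1) - h (real t)"
  let ?C = "{..<n} - X"
  have X: "X \<subseteq> {..<n}" "card X = s" and Y: "Y \<subseteq> {..<n}" using assms by (auto simp: level_def)
  have step: "h (real (card (insert b (X - {a}) - Y)))
      = h (real t) + (of_bool (a \<in> Y) * of_bool (b \<notin> Y) * D + of_bool (a \<notin> Y) * of_bool (b \<in> Y) * E)"
    if "a \<in> X" "b \<in> ?C" for a b
  proof -
    have ins: "insert b (X - {a}) - Y = (if b \<in> Y then X - Y - {a} else insert b (X - Y - {a}))"
      using that by auto
    have cd: "card (X - Y - {a}) = (if a \<in> Y then t else t - 1)"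
      using that c(1) by (auto simp: t_def)
    have pos: "t > 0" if "a \<notin> Y" using that \<open>a \<in> X\<close> c(1) by (auto simp: t_def card_gt_0_iff)
    have "card (insert b (X - Y - {a})) = Suc (card (X - Y - {a}))"
      using that c(1) by simp
    then show ?thesis using pos
      by (auto simp: ins cd D_def E_def of_nat_diff add.commute)
  qed
  have "swap_sum n (\<lambda>Z. h (real (card (Z - Y)))) X
      = (\<Sum>a\<in>X. \<Sum>b\<in>?C. h (real t)
          + (of_bool (a \<in> Y) * of_bool (b \<notin> Y) * D + of_bool (a \<notin> Y) * of_bool (b \<in> Y) * E))"
    unfolding swap_sum_def by (intro sum.cong refl step)
  also have "\<dots> = real (card X) * real (card ?C) * h (real t)
      + (\<Sum>a\<in>X. of_bool (a \<in> Y)) * (\<Sum>b\<in>?C. of_bool (b \<notin> Y)) * D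
      + (\<Sum>a\<in>X. of_bool (a \<notin> Y)) * (\<Sum>b\<in>?C. of_bool (b \<in> Y)) * E"
    by (simp only: sum.distrib sum_product sum_distrib_right sum_distrib_left[symmetric])
      (simp add: sum_distrib_left sum_distrib_right mult.assoc del: sum_of_bool_eq)
  also have "(\<Sum>a\<in>X. of_bool (a \<in> Y)) = real (card (X \<inter> Y))"
    using c(1) by (simp add: Int_def)
  also have "(\<Sum>b\<in>?C. of_bool (b \<notin> Y)) = real (card (?C - Y))"
    by (simp add: set_diff_eq Int_def conj_assoc)
  also have "(\<Sum>a\<in>X. of_bool (a \<notin> Y)) = real t"
    using c(1) by (simp add: t_def set_diff_eq Int_def)
  also have "(\<Sum>b\<in>?C. of_bool (b \<in> Y)) = real (card (Y - X))"
  proof -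
    have "?C \<inter> {b. b \<in> Y} = Y - X" using Y by auto
    then show ?thesis by simp
  qed
  also have "card ?C = n - s" using X c(1) by (simp add: card_Diff_subset)
  finally show ?thesis
    using c(4,7,8) X(2)
    by (simp add: johnson_diff_def t_def[symmetric] D_def E_def power2_eq_square)
qed

text \<open>Columns of kernels of different degrees are eigenvectors of a self-adjoint operator, and the
  difference of the eigenvalues factors as \<open>(k - j)(n + 1 - k - j)\<close>. The second factor is positive
  because \<open>j\<close> is at most one and \<open>k\<close> at most the other of \<open>s\<close> and \<open>n - s\<close>.\<close>

lemma hahn_kernels_orthogonal:
  assumes X: "X \<in> level n s" and Y: "Y \<in> level n s"
    and j: "j \<le> s" "j \<le> n - s" and k: "k \<le> s" "k \<le> n - s" and "j \<noteq> k"
  shows "(\<Sum>Z\<in>level n s. hahn n s j (real (card (X - Z))) * hahn n s k (real (card (Z - Y)))) = 0"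
proof -
  define \<theta> where "\<theta> = (\<lambda>k. real s * real (n - s) - real k * (real n + 1 - real k))"
  define f where "f = (\<lambda>Z. hahn n s j (real (card (Z - X))))"
  define g where "g = (\<lambda>Z. hahn n s k (real (card (Z - Y))))"
  have sn: "s \<le> n" using level_card(3)[OF X Y] .
  have f: "swap_sum n f Z = \<theta> j * f Z" if "Z \<in> level n s" for Z
    unfolding f_def swap_sum_distance[OF that X] johnson_diff_hahn[OF sn j]
    by (simp add: \<theta>_def algebra_simps)
  have g: "swap_sum n g Z = \<theta> k * g Z" if "Z \<in> level n s" for Z
    unfolding g_def swap_sum_distance[OF that Y] johnson_diff_hahn[OF sn k]
    by (simp add: \<theta>_def algebra_simps)
  have "\<theta> k * (\<Sum>Z\<in>level n s. f Z * g Z) = (\<Sum>Z\<in>level n s. f Z * swap_sum n g Z)"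
    using g by (simp add: sum_distrib_left mult.left_commute)
  also have "\<dots> = \<theta> j * (\<Sum>Z\<in>level n s. f Z * g Z)"
    unfolding swap_sum_self_adjoint using f by (simp add: sum_distrib_left mult.assoc)
  finally have "(\<theta> j - \<theta> k) * (\<Sum>Z\<in>level n s. f Z * g Z) = 0"
    by (simp only: left_diff_distrib diff_self)
  moreover have "\<theta> j - \<theta> k = (real k - real j) * (real n + 1 - real k - real j)"
    by (simp add: \<theta>_def algebra_simps)
  moreover have "real k + real j \<le> real n"
    using j k sn by linarith
  ultimately have "(real k - real j) * (real n + 1 - real k - real j)
      * (\<Sum>Z\<in>level n s. f Z * g Z) = 0" "real n + 1 - real k - real j \<noteq> 0" "real k - real j \<noteq> 0"
    using \<open>j \<noteq> k\<close> by simp_all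
  then have "(\<Sum>Z\<in>level n s. f Z * g Z) = 0" by (simp only: mult_eq_0_iff) blast
  moreover have "f Z = hahn n s j (real (card (X - Z)))" if "Z \<in> level n s" for Z
    unfolding f_def using level_card(4)[OF X that] by simp
  ultimately show ?thesis by (simp add: g_def)
qed

section \<open>The theta number of a graph in the span of orthogonal kernels\<close>

lemma bordered_quadratic_form:
  assumes "finite V" and sym: "\<forall>x\<in>V. \<forall>y\<in>V. F x y = F y x"
  shows "(\<Sum>i\<in>insert None (Some ` V). \<Sum>j\<in>insert None (Some ` V). c i * bordered F i j * c j)
    = (c None)\<^sup>2 + 2 * c None * (\<Sum>x\<in>V. F x x * c (Some x))
      + (\<Sum>x\<in>V. \<Sum>y\<in>V. c (Some x) * F x y * c (Some y))"
  using assms(1)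
  by (simp add: sum.reindex sum.distrib sum_distrib_left power2_eq_square algebra_simps)

text \<open>The kernels \<open>Q\<^sub>k(|X - Y|)\<close> enter the computation of the theta number through properties that make
  sense on any vertex set. The value \<open>q k\<close> on the edges turns out to be the
  eigenvalue of the graph on the range of \<open>K k\<close> divided by the degree.\<close>

locale kernel_graph =
  fixes V :: "'a set" and m :: nat and K :: "nat \<Rightarrow> 'a \<Rightarrow> 'a \<Rightarrow> real"
    and adj :: "'a \<Rightarrow> 'a \<Rightarrow> bool" and q :: "nat \<Rightarrow> real"
  assumes finite_V: "finite V" and V_nonempty: "V \<noteq> {}"
    and K_sym: "\<And>k x y. \<lbrakk>k \<le> m; x \<in> V; y \<in> V\<rbrakk> \<Longrightarrow> K k x y = K k y x"
    and K_diag: "\<And>k x. \<lbrakk>k \<le> m; x \<in> V\<rbrakk> \<Longrightarrow> K k x x = 1"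
    and K_0: "\<And>x y. \<lbrakk>x \<in> V; y \<in> V\<rbrakk> \<Longrightarrow> K 0 x y = 1"
    and K_orth: "\<And>j k x y. \<lbrakk>j \<le> m; k \<le> m; j \<noteq> k; x \<in> V; y \<in> V\<rbrakk>
                   \<Longrightarrow> (\<Sum>z\<in>V. K j x z * K k z y) = 0"
    and id_in_span: "\<exists>w. \<forall>x\<in>V. \<forall>y\<in>V. of_bool (x = y) = (\<Sum>k\<le>m. w k * K k x y)"
    and adj_in_span: "\<exists>b. \<forall>x\<in>V. \<forall>y\<in>V. of_bool (adj x y) = (\<Sum>k\<le>m. b k * K k x y)"
    and K_adj: "\<And>k x y. \<lbrakk>k \<le> m; x \<in> V; y \<in> V; adj x y\<rbrakk> \<Longrightarrow> K k x y = q k"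
    and adj_irrefl: "\<And>x. x \<in> V \<Longrightarrow> \<not> adj x x"
    and adj_exists: "\<And>x. x \<in> V \<Longrightarrow> \<exists>y\<in>V. adj x y"
begin

lemma q_0: "q 0 = 1"
proof -
  obtain x where "x \<in> V" using V_nonempty by blast
  moreover obtain y where "y \<in> V" "adj x y" using adj_exists[OF \<open>x \<in> V\<close>] by blast
  ultimately show ?thesis using K_adj[of 0 x y] K_0[of x y] by simp
qed

lemma span_times_kernel:
  assumes "\<forall>x\<in>V. \<forall>y\<in>V. M x y = (\<Sum>j\<le>m. w j * K j x y)" "k \<le> m" "x \<in> V" "y \<in> V"
  shows "(\<Sum>z\<in>V. M x z * K k z y) = w k * (\<Sum>z\<in>V. K k x z * K k z y)"
proof -
  have "(\<Sum>z\<in>V. M x z * K k z y) = (\<Sum>z\<in>V. \<Sum>j\<le>m. w j * (K j x z * K k z y))"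
    using assms by (intro sum.cong refl) (simp add: sum_distrib_right mult.assoc)
  also have "\<dots> = (\<Sum>j\<le>m. w j * (\<Sum>z\<in>V. K j x z * K k z y))"
    by (subst sum.swap) (simp add: sum_distrib_left)
  also have "\<dots> = (\<Sum>j\<le>m. if j = k then w k * (\<Sum>z\<in>V. K k x z * K k z y) else 0)"
    using assms by (intro sum.cong refl) (auto simp: K_orth)
  finally show ?thesis using assms by simp
qed

text \<open>Multiplying the expansion of the identity by \<open>K k\<close> leaves one term, so \<open>K k\<close> is a multiple of its
  square; the diagonal entries show that the factor \<open>w k\<close> is positive. Multiplying the expansion of the
  adjacency matrix by \<open>K k\<close> and reading off a diagonal entry expresses its coefficients by the \<open>w k\<close>
  and the degree \<open>d\<close> of that vertex.\<close>

lemma spectral_decomposition: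
  obtains w d where "d > 0" "\<And>k. k \<le> m \<Longrightarrow> w k > 0" "w 0 = 1 / real (card V)"
    and "\<And>x y. \<lbrakk>x \<in> V; y \<in> V\<rbrakk> \<Longrightarrow> of_bool (x = y) = (\<Sum>k\<le>m. w k * K k x y)"
    and "\<And>x y. \<lbrakk>x \<in> V; y \<in> V\<rbrakk> \<Longrightarrow> of_bool (adj x y) = d * (\<Sum>k\<le>m. w k * q k * K k x y)"
    and "\<And>k x y. \<lbrakk>k \<le> m; x \<in> V; y \<in> V\<rbrakk> \<Longrightarrow> K k x y = w k * (\<Sum>z\<in>V. K k x z * K k z y)"
proof -
  obtain w where w: "\<forall>x\<in>V. \<forall>y\<in>V. of_bool (x = y) = (\<Sum>k\<le>m. w k * K k x y)"
    using id_in_span by blast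
  obtain b where b: "\<forall>x\<in>V. \<forall>y\<in>V. of_bool (adj x y) = (\<Sum>k\<le>m. b k * K k x y)"
    using adj_in_span by blast
  obtain x0 where x0: "x0 \<in> V" using V_nonempty by blast
  have idem: "K k x y = w k * (\<Sum>z\<in>V. K k x z * K k z y)" if "k \<le> m" "x \<in> V" "y \<in> V" for k x y
  proof -
    have "(\<Sum>z\<in>V. of_bool (x = z) * K k z y) = K k x y"
      using that finite_V by simp
    then show ?thesis using span_times_kernel[OF w that] by simp
  qed
  have wpos: "w k > 0" if "k \<le> m" for k
  proof -
    have "1 = w k * (\<Sum>z\<in>V. (K k x0 z)\<^sup>2)"
      using idem[OF that x0 x0] K_diag[OF that x0] K_sym[OF that _ x0]
      by (simp add: power2_eq_square)
    moreover have "(\<Sum>z\<in>V. (K k x0 z)\<^sup>2) \<ge> 0" by (simp add: sum_nonneg)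
    ultimately show ?thesis by (metis zero_less_mult_pos2 zero_less_one mult_zero_right less_eq_real_def)
  qed
  have w0: "w 0 = 1 / real (card V)"
  proof -
    have "1 = w 0 * (\<Sum>z\<in>V. 1)"
      using idem[of 0 x0 x0] K_0 x0 by simp
    moreover have "card V \<noteq> 0" using finite_V V_nonempty by simp
    ultimately show ?thesis by (simp add: field_simps)
  qed
  define d where "d = (\<Sum>z\<in>V. of_bool (adj x0 z) :: real)"
  have bw: "b k = d * (w k * q k)" if k: "k \<le> m" for k
  proof -
    have "q k * d = (\<Sum>z\<in>V. of_bool (adj x0 z) * K k z x0)"
      unfolding d_def sum_distrib_left
      using K_adj[OF k x0] K_sym[OF k x0] by (intro sum.cong refl) auto
    also have "\<dots> = b k * (\<Sum>z\<in>V. K k x0 z * K k z x0)"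
      by (rule span_times_kernel[OF b k x0 x0])
    finally have "w k * (q k * d) = b k * K k x0 x0"
      using idem[OF k x0 x0] by (metis mult.left_commute)
    then show ?thesis using K_diag[OF k x0] by (simp add: mult_ac)
  qed
  have "d > 0"
  proof -
    obtain y where "y \<in> V" "adj x0 y" using adj_exists[OF x0] by blast
    then show ?thesis unfolding d_def using finite_V by (intro sum_pos2[of V y]) auto
  qed
  moreover have "of_bool (adj x y) = d * (\<Sum>k\<le>m. w k * q k * K k x y)" if "x \<in> V" "y \<in> V" for x y
    using b that bw by (simp add: sum_distrib_left mult.assoc)
  ultimately show ?thesis using that wpos w0 w idem by blast
qed

text \<open>By idempotence each kernel is a positive multiple of the Gram matrix of its own columns, so its
  entrywise pairing with \<open>F\<close> is a positive combination of values of the quadratic form of \<open>F\<close> at these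
  columns. For \<open>F = v v\<^sup>T\<close> this says that the kernel itself is positive semidefinite.\<close>

lemma kernel_pairing_nonneg:
  assumes k: "k \<le> m" and F: "\<And>c. 0 \<le> (\<Sum>x\<in>V. \<Sum>y\<in>V. c x * F x y * c y)"
  shows "0 \<le> (\<Sum>x\<in>V. \<Sum>y\<in>V. F x y * K k x y)"
proof -
  obtain w d where wpos: "\<And>k. k \<le> m \<Longrightarrow> w k > (0::real)"
    and idem: "\<And>k x y. \<lbrakk>k \<le> m; x \<in> V; y \<in> V\<rbrakk> \<Longrightarrow> K k x y = w k * (\<Sum>z\<in>V. K k x z * K k z y)"
    by (rule spectral_decomposition) blast
  have "(\<Sum>x\<in>V. \<Sum>y\<in>V. F x y * K k x y)
      = (\<Sum>x\<in>V. \<Sum>y\<in>V. \<Sum>z\<in>V. w k * (K k x z * F x y * K k y z))"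
  proof (intro sum.cong refl)
    fix x y assume xy: "x \<in> V" "y \<in> V"
    have "K k x y = (\<Sum>z\<in>V. w k * (K k x z * K k y z))"
      unfolding sum_distrib_left[symmetric] idem[OF k xy]
      using K_sym[OF k xy(2)] by simp
    then show "F x y * K k x y = (\<Sum>z\<in>V. w k * (K k x z * F x y * K k y z))"
      by (simp add: sum_distrib_left mult_ac)
  qed
  also have "\<dots> = (\<Sum>x\<in>V. \<Sum>z\<in>V. \<Sum>y\<in>V. w k * (K k x z * F x y * K k y z))"
    by (intro sum.cong refl sum.swap)
  also have "\<dots> = (\<Sum>z\<in>V. \<Sum>x\<in>V. \<Sum>y\<in>V. w k * (K k x z * F x y * K k y z))"
    by (rule sum.swap)
  also have "\<dots> = w k * (\<Sum>z\<in>V. \<Sum>x\<in>V. \<Sum>y\<in>V. K k x z * F x y * K k y z)"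
    by (simp add: sum_distrib_left)
  also have "\<dots> \<ge> 0"
    using F wpos[OF k]
    by (intro mult_nonneg_nonneg sum_nonneg[of V "\<lambda>z. \<Sum>x\<in>V. \<Sum>y\<in>V. K k x z * F x y * K k y z"]) auto
  finally show ?thesis .
qed

definition min_q :: real where
  "min_q = Min (q ` {..m})"

lemma min_q_le: "k \<le> m \<Longrightarrow> min_q \<le> q k"
  unfolding min_q_def by simp

lemma min_q_attained: obtains k where "k \<le> m" "q k = min_q"
proof -
  have "min_q \<in> q ` {..m}" unfolding min_q_def by (rule Min_in) auto
  then show ?thesis using that by auto
qed

text \<open>The adjacency matrix has trace zero and, on constant vectors, a positive eigenvalue, so
  another eigenvalue is negative.\<close>

lemma min_q_negative: "min_q < 0"
proof (rule ccontr)
  assume "\<not> min_q < 0"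
  then have nonneg: "q k \<ge> 0" if "k \<le> m" for k using min_q_le[OF that] by linarith
  obtain w d where wd: "d > (0::real)" "\<And>k. k \<le> m \<Longrightarrow> w k > 0"
    and A: "\<And>x y. \<lbrakk>x \<in> V; y \<in> V\<rbrakk> \<Longrightarrow> of_bool (adj x y) = d * (\<Sum>k\<le>m. w k * q k * K k x y)"
    by (rule spectral_decomposition) blast
  obtain x where x: "x \<in> V" using V_nonempty by blast
  have "0 = d * (\<Sum>k\<le>m. w k * q k)"
    using A[OF x x] adj_irrefl[OF x] K_diag[OF _ x] by simp
  moreover have "(\<Sum>k\<le>m. w k * q k) > 0"
    using wd(2) nonneg q_0 by (intro sum_pos2[of _ 0]) (auto simp: less_imp_le)
  ultimately show False using wd(1) by simp
qed

text \<open>With \<open>p k\<close> the pairing of \<open>F\<close> and \<open>K k\<close>, the trace of \<open>F\<close> is \<open>\<Sum>k. w k * p k\<close> and the vanishing on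
  the edges says \<open>\<Sum>k. w k * q k * p k = 0\<close>. Subtracting \<open>min_q\<close> times the former from the latter makes
  all terms nonnegative, and only the term of \<open>k = 0\<close>, which is the sum of all entries of \<open>F\<close>, is
  kept.\<close>

lemma trace_upper_bound:
  assumes psd: "psd_on (insert None (Some ` V)) (bordered F)"
    and zero: "\<And>x y. \<lbrakk>x \<in> V; y \<in> V; adj x y\<rbrakk> \<Longrightarrow> F x y = 0"
  shows "(\<Sum>x\<in>V. F x x) \<le> real (card V) * (min_q / (min_q - 1))"
proof -
  obtain w d where d: "d > (0::real)" and wpos: "\<And>k. k \<le> m \<Longrightarrow> w k > 0"
    and w0: "w 0 = 1 / real (card V)"
    and I: "\<And>x y. \<lbrakk>x \<in> V; y \<in> V\<rbrakk> \<Longrightarrow> of_bool (x = y) = (\<Sum>k\<le>m. w k * K k x y)"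
    and A: "\<And>x y. \<lbrakk>x \<in> V; y \<in> V\<rbrakk> \<Longrightarrow> of_bool (adj x y) = d * (\<Sum>k\<le>m. w k * q k * K k x y)"
    by (rule spectral_decomposition) blast
  define N S where "N = real (card V)" and "S = (\<Sum>x\<in>V. F x x)"
  have Npos: "N > 0" using finite_V V_nonempty by (simp add: N_def card_gt_0_iff)
  define p where "p = (\<lambda>k. \<Sum>x\<in>V. \<Sum>y\<in>V. F x y * K k x y)"
  have sym: "\<forall>x\<in>V. \<forall>y\<in>V. F x y = F y x"
  proof (intro ballI)
    fix x y assume "x \<in> V" "y \<in> V"
    then have "bordered F (Some x) (Some y) = bordered F (Some y) (Some x)"
      using psd unfolding psd_on_def by blast
    then show "F x y = F y x" by simp
  qed
  have quad: "0 \<le> (c None)\<^sup>2 + 2 * c None * (\<Sum>x\<in>V. F x x * c (Some x))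
      + (\<Sum>x\<in>V. \<Sum>y\<in>V. c (Some x) * F x y * c (Some y))" for c
    using psd unfolding psd_on_def bordered_quadratic_form[OF finite_V sym, symmetric] by blast
  have pnonneg: "p k \<ge> 0" if k: "k \<le> m" for k
  proof -
    have "0 \<le> (\<Sum>x\<in>V. \<Sum>y\<in>V. c x * F x y * c y)" for c
      using quad[of "\<lambda>i. case i of None \<Rightarrow> 0 | Some x \<Rightarrow> c x"] by simp
    then show ?thesis unfolding p_def by (rule kernel_pairing_nonneg[OF k])
  qed
  \<comment> \<open>The value at \<open>(-S, 1, \<dots>, 1)\<close>, where the quadratic form is smallest as a function of its
     first coordinate.\<close>
  have p0: "p 0 \<ge> S\<^sup>2"
  proof -
    have "p 0 = (\<Sum>x\<in>V. \<Sum>y\<in>V. F x y)"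
      unfolding p_def by (intro sum.cong refl) (simp add: K_0)
    then show ?thesis
      using quad[of "\<lambda>i. case i of None \<Rightarrow> - S | Some x \<Rightarrow> 1"]
      by (simp add: S_def[symmetric] power2_eq_square)
  qed
  have pair: "(\<Sum>x\<in>V. \<Sum>y\<in>V. F x y * (\<Sum>k\<le>m. v k * K k x y)) = (\<Sum>k\<le>m. v k * p k)" for v
  proof -
    have "(\<Sum>x\<in>V. \<Sum>y\<in>V. F x y * (\<Sum>k\<le>m. v k * K k x y))
        = (\<Sum>x\<in>V. \<Sum>k\<le>m. \<Sum>y\<in>V. v k * (F x y * K k x y))"
      by (subst (2) sum.swap) (simp add: sum_distrib_left mult.left_commute)
    also have "\<dots> = (\<Sum>k\<le>m. v k * p k)"
      by (subst sum.swap) (simp add: sum_distrib_left p_def)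
    finally show ?thesis .
  qed
  have trace: "S = (\<Sum>k\<le>m. w k * p k)"
  proof -
    have "S = (\<Sum>x\<in>V. \<Sum>y\<in>V. F x y * of_bool (x = y))"
      using finite_V by (simp add: S_def)
    also have "\<dots> = (\<Sum>x\<in>V. \<Sum>y\<in>V. F x y * (\<Sum>k\<le>m. w k * K k x y))"
      by (intro sum.cong refl) (simp only: I)
    finally show ?thesis by (simp only: pair)
  qed
  have edges: "(\<Sum>k\<le>m. w k * q k * p k) = 0"
  proof -
    have "0 = (\<Sum>x\<in>V. \<Sum>y\<in>V. F x y * of_bool (adj x y))"
      using zero by (intro sum.neutral[symmetric] ballI sum.neutral) auto
    also have "\<dots> = (\<Sum>x\<in>V. \<Sum>y\<in>V. F x y * (\<Sum>k\<le>m. d * (w k * q k) * K k x y))"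
      by (intro sum.cong refl) (simp only: A sum_distrib_left mult.assoc)
    also have "\<dots> = d * (\<Sum>k\<le>m. w k * q k * p k)"
      unfolding pair by (simp add: sum_distrib_left mult.assoc)
    finally show ?thesis using d by simp
  qed
  have "(1 - min_q) * S\<^sup>2 / N \<le> w 0 * (q 0 - min_q) * p 0"
    using p0 min_q_negative Npos by (simp add: w0 q_0 N_def divide_right_mono)
  also have "\<dots> \<le> (\<Sum>k\<le>m. w k * (q k - min_q) * p k)"
    using wpos min_q_le pnonneg
    by (intro member_le_sum) (auto intro!: mult_nonneg_nonneg simp: less_imp_le)
  also have "\<dots> = (\<Sum>k\<le>m. w k * q k * p k) - min_q * (\<Sum>k\<le>m. w k * p k)"
    by (simp add: sum_subtractf[symmetric] sum_distrib_left algebra_simps)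
  also have "\<dots> = - min_q * S"
    using edges trace by simp
  finally have key: "(1 - min_q) * S * S \<le> - min_q * N * S"
    using Npos by (simp add: power2_eq_square field_simps)
  have "(1 - min_q) * S \<le> - min_q * N"
  proof (cases "S > 0")
    case True
    with key show ?thesis by (rule mult_right_le_imp_le)
  next
    case False
    then have "(1 - min_q) * S \<le> 0" using min_q_negative by (simp add: mult_nonneg_nonpos)
    also have "0 \<le> - min_q * N" using min_q_negative Npos by (simp add: mult_nonpos_nonneg)
    finally show ?thesis .
  qed
  then have "S \<le> N * (min_q / (min_q - 1))"
    using min_q_negative by (simp add: field_simps)
  then show ?thesis by (simp add: S_def N_def)
qed

text \<open>For \<open>F = \<alpha> J + \<beta> K k\<close> with \<open>q k = min_q\<close> to vanish on the edges, \<open>\<alpha> = - \<beta> min_q\<close> is forced. The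
  diagonal is then constant, equal to \<open>c = \<alpha> + \<beta>\<close>, and \<open>R(F)\<close> is positive semidefinite as soon as
  \<open>\<alpha> \<ge> c\<^sup>2\<close>. Equality in this condition determines \<open>\<beta>\<close> and gives the largest diagonal.\<close>

lemma trace_bound_attained:
  obtains F where "psd_on (insert None (Some ` V)) (bordered F)"
    and "\<And>x y. \<lbrakk>x \<in> V; y \<in> V; adj x y\<rbrakk> \<Longrightarrow> F x y = 0"
    and "\<And>x. x \<in> V \<Longrightarrow> F x x = min_q / (min_q - 1)"
proof -
  obtain k where k: "k \<le> m" and qk: "q k = min_q" by (rule min_q_attained)
  define c where "c = min_q / (min_q - 1)"
  define \<beta> where "\<beta> = - min_q / (1 - min_q)\<^sup>2"
  have neg: "min_q < 0" by (rule min_q_negative)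
  have \<beta>: "\<beta> \<ge> 0" unfolding \<beta>_def using neg by (intro divide_nonneg_nonneg) auto
  have c2: "c\<^sup>2 = - \<beta> * min_q"
    unfolding c_def \<beta>_def by (simp add: power_divide power2_eq_square algebra_simps)
  have cc: "c\<^sup>2 + \<beta> = c"
  proof -
    have "c\<^sup>2 + \<beta> = \<beta> * (1 - min_q)" unfolding c2 by (simp add: algebra_simps)
    also have "\<dots> = - min_q / (1 - min_q)"
      unfolding \<beta>_def using neg by (simp add: power2_eq_square)
    also have "\<dots> = c" unfolding c_def using neg by (simp add: field_simps)
    finally show ?thesis .
  qed
  define F where "F = (\<lambda>x y. c\<^sup>2 + \<beta> * K k x y)"
  have diag: "F x x = c" if "x \<in> V" for x using K_diag[OF k that] cc by (simp add: F_def)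
  have sym: "\<forall>x\<in>V. \<forall>y\<in>V. F x y = F y x" using K_sym[OF k] by (simp add: F_def)
  have Kpsd: "0 \<le> (\<Sum>x\<in>V. \<Sum>y\<in>V. v x * K k x y * v y)" for v
  proof -
    have "0 \<le> (\<Sum>x\<in>V. \<Sum>y\<in>V. u x * (v x * v y) * u y)" for u
    proof -
      have "(\<Sum>x\<in>V. \<Sum>y\<in>V. u x * (v x * v y) * u y) = (\<Sum>x\<in>V. u x * v x)\<^sup>2"
        unfolding power2_eq_square sum_product by (intro sum.cong refl) (simp only: mult_ac)
      then show ?thesis by simp
    qed
    then have "0 \<le> (\<Sum>x\<in>V. \<Sum>y\<in>V. (v x * v y) * K k x y)"
      by (rule kernel_pairing_nonneg[OF k])
    then show ?thesis by (simp only: mult_ac)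
  qed
  have "psd_on (insert None (Some ` V)) (bordered F)"
    unfolding psd_on_def
  proof (intro conjI ballI allI)
    fix i j assume "i \<in> insert None (Some ` V)" "j \<in> insert None (Some ` V)"
    then show "bordered F i j = bordered F j i"
      using sym by (elim insertE imageE) (simp_all only: bordered.simps)
  next
    fix v :: "'a option \<Rightarrow> real"
    have "(\<Sum>x\<in>V. \<Sum>y\<in>V. v (Some x) * F x y * v (Some y))
        = c\<^sup>2 * (\<Sum>x\<in>V. v (Some x))\<^sup>2 + \<beta> * (\<Sum>x\<in>V. \<Sum>y\<in>V. v (Some x) * K k x y * v (Some y))"
    proof -
      have "(\<Sum>x\<in>V. \<Sum>y\<in>V. v (Some x) * F x y * v (Some y))
          = (\<Sum>x\<in>V. \<Sum>y\<in>V. c\<^sup>2 * (v (Some x) * v (Some y)) + \<beta> * (v (Some x) * K k x y * v (Some y)))"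
        by (intro sum.cong refl) (simp add: F_def algebra_simps)
      then show ?thesis
        by (simp only: sum.distrib sum_distrib_left[symmetric])
          (simp only: power2_eq_square sum_distrib_right[symmetric])
    qed
    moreover have "(\<Sum>x\<in>V. F x x * v (Some x)) = c * (\<Sum>x\<in>V. v (Some x))"
      using diag by (simp add: sum_distrib_left)
    ultimately have "(\<Sum>i\<in>insert None (Some ` V). \<Sum>j\<in>insert None (Some ` V). v i * bordered F i j * v j)
        = (v None + c * (\<Sum>x\<in>V. v (Some x)))\<^sup>2
          + \<beta> * (\<Sum>x\<in>V. \<Sum>y\<in>V. v (Some x) * K k x y * v (Some y))"
      unfolding bordered_quadratic_form[OF finite_V sym]
      by (simp add: power2_eq_square algebra_simps)
    also have "\<dots> \<ge> 0"
      using \<beta> Kpsd[of "\<lambda>x. v (Some x)"] by simp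
    finally show "0 \<le> (\<Sum>i\<in>insert None (Some ` V). \<Sum>j\<in>insert None (Some ` V). v i * bordered F i j * v j)" .
  qed
  moreover have "F x y = 0" if "x \<in> V" "y \<in> V" "adj x y" for x y
    using K_adj[OF k that] qk c2 by (simp add: F_def)
  ultimately show ?thesis using that diag unfolding c_def by blast
qed

end

section \<open>The theta body of a graph\<close>

text \<open>Every vertex of the link of \<open>x\<close> is itself an edge of the link, so only the empty set is
  independent.\<close>

lemma IND_link_of_graph:
  assumes "uniform 2 H"
  shows "IND (hyp_link H x) = {\<lambda>y\<in>hverts (hyp_link H x). 0}"
proof -
  define Vx where "Vx = hverts (hyp_link H x)"
  have edge: "{y} \<in> hedges (hyp_link H x)" if "y \<in> Vx" for y
  proof -
    from that obtain e where e: "y \<noteq> x" "e \<in> hedges H" "x \<in> e" "y \<in> e"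
      by (auto simp: Vx_def hyp_link_def Let_def)
    have "finite e" "card e = 2" using assms e(2) by (auto simp: uniform_def)
    then have "{x, y} = e" using e by (intro card_subset_eq) auto
    then have "{y} \<union> {x} \<in> hedges H" using e(2) by (simp add: insert_commute)
    then show ?thesis using that by (simp add: hyp_link_def Let_def Vx_def)
  qed
  have indep: "independent_in (hyp_link H x) I \<longleftrightarrow> I = {}" for I
  proof
    assume I: "independent_in (hyp_link H x) I"
    show "I = {}"
    proof (rule ccontr)
      assume "I \<noteq> {}"
      then obtain y where "y \<in> I" by blast
      moreover from this I have "y \<in> Vx" by (auto simp: independent_in_def Vx_def)
      ultimately show False using I edge[of y] by (auto simp: independent_in_def)
    qed
  next
    assume "I = {}"
    moreover have "e \<noteq> {}" if "e \<in> hedges (hyp_link H x)" for e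
    proof
      assume "e = {}"
      with that have "{x} \<in> hedges H" by (simp add: hyp_link_def Let_def)
      then have "card {x} = 2" using assms unfolding uniform_def by blast
      then show False by simp
    qed
    ultimately show "independent_in (hyp_link H x) I"
      by (auto simp: independent_in_def)
  qed
  define z :: "'a \<Rightarrow> real" where "z = (\<lambda>y\<in>Vx. 0)"
  have ind: "IND (hyp_link H x) = conv_on Vx {z}"
    unfolding IND_def indep Vx_def[symmetric] z_def by (simp add: restrict_def cong: if_cong)
  have "f = z" if f: "f \<in> conv_on Vx {z}" for f
  proof -
    obtain T c where "T \<subseteq> {z}" "f = (\<lambda>v\<in>Vx. \<Sum>g\<in>T. c g * g v)"
      using f unfolding conv_on_def by blast
    moreover from this have "(\<Sum>g\<in>T. c g * g v) = 0" if "v \<in> Vx" for v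
      using that by (intro sum.neutral) (auto simp: z_def)
    ultimately show ?thesis by (simp add: z_def fun_eq_iff restrict_def)
  qed
  moreover have "z \<in> conv_on Vx {z}"
    unfolding conv_on_def
    by (rule CollectI, rule exI[of _ "{z}"], rule exI[of _ "\<lambda>_. 1"]) (simp add: z_def fun_eq_iff)
  ultimately show ?thesis unfolding ind Vx_def[symmetric] z_def[symmetric] by blast
qed

lemma theta_body_graph:
  assumes "uniform 2 H"
  shows "theta_body 2 H =
    {f \<in> extensional (hverts H). \<exists>F. (\<forall>x\<in>hverts H. f x = F x x) \<and>
       (\<forall>x\<in>hverts H. \<forall>y\<in>hverts H. {x, y} \<in> hedges H \<longrightarrow> F x y = 0) \<and>
       psd_on (insert None (Some ` hverts H)) (bordered F)}"
proof -
  have row: "(let Vx = hverts (hyp_link H x) in Vx \<noteq> {} \<longrightarrow>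
          restrict (F x) Vx \<in> (\<lambda>g. \<lambda>y\<in>Vx. F x x * g y) ` theta_body (Suc 0) (hyp_link H x))
        \<longleftrightarrow> (\<forall>y\<in>hverts H. {x, y} \<in> hedges H \<longrightarrow> F x y = 0)"
    if x: "x \<in> hverts H" for x F
  proof -
    define Vx where "Vx = hverts (hyp_link H x)"
    have Vx: "y \<in> Vx \<longleftrightarrow> y \<in> hverts H \<and> {x, y} \<in> hedges H" for y
    proof
      assume "y \<in> Vx"
      then obtain e where e: "y \<in> hverts H" "y \<noteq> x" "e \<in> hedges H" "x \<in> e" "y \<in> e"
        by (auto simp: Vx_def hyp_link_def Let_def)
      have "finite e" "card e = 2" using assms e(3) by (auto simp: uniform_def)
      then have "{x, y} = e" using e by (intro card_subset_eq) auto
      then show "y \<in> hverts H \<and> {x, y} \<in> hedges H" using e by simp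
    next
      assume y: "y \<in> hverts H \<and> {x, y} \<in> hedges H"
      then have "card {x, y} = 2" using assms unfolding uniform_def by blast
      then have "x \<noteq> y" by auto
      then show "y \<in> Vx" using y by (auto simp: Vx_def hyp_link_def Let_def)
    qed
    have "restrict (F x) Vx \<in> (\<lambda>g. \<lambda>y\<in>Vx. F x x * g y) ` {\<lambda>y\<in>Vx. 0}
        \<longleftrightarrow> (\<forall>y\<in>Vx. F x y = 0)"
      by (auto simp: fun_eq_iff restrict_def)
    then show ?thesis
      unfolding theta_body.simps(1) IND_link_of_graph[OF assms] Let_def Vx_def[symmetric]
      using Vx by auto
  qed
  show ?thesis
    unfolding numeral_2_eq_2 theta_body.simps(2) using row by (intro Collect_cong) (simp cong: conj_cong)
qed

section \<open>Words of constant weight\<close>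

definition support :: "bool list \<Rightarrow> nat set" where
  "support x = {i. i < length x \<and> x ! i}"

lemma finite_support [simp]: "finite (support x)"
  by (simp add: support_def)

lemma weight_eq_card_support: "weight x = card (support x)"
  by (simp add: weight_def support_def count_list_eq_length_filter length_filter_conv_card
      eq_commute[of True])

lemma bij_betw_support: "bij_betw support (weight_words n s) (level n s)"
proof (rule bij_betw_byWitness[where f' = "\<lambda>X. map (\<lambda>i. i \<in> X) [0..<n]"])
  show "\<forall>x\<in>weight_words n s. map (\<lambda>i. i \<in> support x) [0..<n] = x"
    by (auto simp: weight_words_def cube_def support_def intro!: nth_equalityI)
  have inv: "support (map (\<lambda>i. i \<in> X) [0..<n]) = X" if "X \<in> level n s" for X
    using that by (auto simp: support_def level_def)
  then show "\<forall>X\<in>level n s. support (map (\<lambda>i. i \<in> X) [0..<n]) = X" by blast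
  show "support ` weight_words n s \<subseteq> level n s"
    by (auto simp: weight_words_def cube_def level_def weight_eq_card_support)
      (auto simp: support_def)
  show "(\<lambda>X. map (\<lambda>i. i \<in> X) [0..<n]) ` level n s \<subseteq> weight_words n s"
    using inv by (auto simp: weight_words_def cube_def weight_eq_card_support) (auto simp: level_def)
qed

lemma support_in_level: "x \<in> weight_words n s \<Longrightarrow> support x \<in> level n s"
  using bij_betw_support by (rule bij_betw_apply)

lemma hamming_dist_support:
  assumes "length x = length y"
  shows "hamming_dist x y = card (support x - support y) + card (support y - support x)"
proof -
  have "{i. i < length x \<and> x ! i \<noteq> y ! i} = (support x - support y) \<union> (support y - support x)"
    using assms by (auto simp: support_def)
  then show ?thesis
    unfolding hamming_dist_def by (simp only:) (rule card_Un_disjoint; auto)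
qed

lemma hamming_dist_weight_words:
  assumes "x \<in> weight_words n s" "y \<in> weight_words n s"
  shows "hamming_dist x y = 2 * card (support x - support y)"
proof -
  have "length x = length y" using assms by (simp add: weight_words_def cube_def)
  then show ?thesis
    using hamming_dist_support level_card(4)[OF support_in_level support_in_level, OF assms] by simp
qed

lemma support_zero_word [simp]: "support (zero_word n) = {}"
  by (auto simp: support_def zero_word_def)

lemma weight_words_iff_dist_zero:
  "x \<in> weight_words n s \<longleftrightarrow> x \<in> cube n \<and> hamming_dist (zero_word n) x = s"
proof -
  have "length (zero_word n) = n" by (simp add: zero_word_def)
  then show ?thesis
    using hamming_dist_support[of "zero_word n" x]
    by (auto simp: weight_words_def cube_def weight_eq_card_support)
qed

lemma hamming_dist_commute: "length x = length y \<Longrightarrow> hamming_dist x y = hamming_dist y x"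
  by (auto simp: hamming_dist_def intro: arg_cong[of _ _ card])

lemma hamming_dist_self [simp]: "hamming_dist x x = 0"
  by (simp add: hamming_dist_def)

lemma weight_word_at_distance:
  assumes x: "x \<in> weight_words n s" and r: "r \<le> s" "r \<le> n - s"
  shows "\<exists>y\<in>weight_words n s. hamming_dist x y = 2 * r"
proof -
  let ?X = "support x"
  have X: "?X \<subseteq> {..<n}" "card ?X = s" using support_in_level[OF x] by (auto simp: level_def)
  obtain A where A: "A \<subseteq> ?X" "card A = r" using obtain_subset_with_card_n[of r ?X] r X by auto
  have "card ({..<n} - ?X) = n - s" using X by (simp add: card_Diff_subset)
  then obtain B where B: "B \<subseteq> {..<n} - ?X" "card B = r"
    using obtain_subset_with_card_n[of r "{..<n} - ?X"] r by auto
  have fin: "finite A" "finite B" using A B finite_subset by (blast intro: finite_support, blast)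
  define Y where "Y = (?X - A) \<union> B"
  have "card Y = (s - r) + r"
    unfolding Y_def using A B X fin by (subst card_Un_disjoint) (auto simp: card_Diff_subset)
  then have "Y \<in> level n s" using X B r by (auto simp: level_def Y_def)
  then obtain y where y: "y \<in> weight_words n s" "support y = Y"
    using bij_betw_support[of n s] unfolding bij_betw_def by (metis imageE)
  have "?X - Y = A" using A B by (auto simp: Y_def)
  then show ?thesis using hamming_dist_weight_words[OF x y(1)] y A by auto
qed

text \<open>The bound on \<open>s\<close> ensures that every word of weight \<open>s\<close> lies in some \<open>s\<close>-triangle with the zero word
  and hence is a vertex of the link.\<close>

lemma
  assumes s: "even s" "0 < s" "s div 2 \<le> n - s"
  defines "G \<equiv> hyp_link (triangle_hypergraph n s) (zero_word n)"
  shows hverts_zero_link: "hverts G = weight_words n s"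
    and hedges_zero_link: "\<And>x y. \<lbrakk>x \<in> weight_words n s; y \<in> weight_words n s\<rbrakk>
          \<Longrightarrow> {x, y} \<in> hedges G \<longleftrightarrow> hamming_dist x y = s"
proof -
  let ?z = "zero_word n" and ?H = "triangle_hypergraph n s"
  have z: "?z \<in> cube n" by (simp add: zero_word_def cube_def)
  have len: "length x = n" if "x \<in> cube n" for x using that by (simp add: cube_def)
  have triangle: "{?z, x, y} \<in> hedges ?H"
    if x: "x \<in> weight_words n s" and y: "y \<in> weight_words n s" and xy: "hamming_dist x y = s" for x y
  proof -
    have d: "x \<in> cube n" "y \<in> cube n" "hamming_dist ?z x = s" "hamming_dist ?z y = s"
      using x y by (auto simp: weight_words_iff_dist_zero)
    moreover from this have "hamming_dist x ?z = s" "hamming_dist y ?z = s" "hamming_dist y x = s"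
      using hamming_dist_commute[of _ ?z] hamming_dist_commute[of y x] xy z len by auto
    moreover have "x \<noteq> y" "?z \<noteq> x" "?z \<noteq> y" using d xy s(2) by auto
    ultimately show ?thesis using xy z by (auto simp: triangle_hypergraph_def)
  qed
  have "y \<in> weight_words n s" if "y \<in> hverts G" for y
    using that
    by (auto simp: G_def hyp_link_def Let_def triangle_hypergraph_def weight_words_iff_dist_zero)
  moreover have "x \<in> hverts G" if x: "x \<in> weight_words n s" for x
  proof -
    have "\<exists>y\<in>weight_words n s. hamming_dist x y = 2 * (s div 2)"
      using s by (intro weight_word_at_distance[OF x]) auto
    then obtain y where y: "y \<in> weight_words n s" "hamming_dist x y = s" using s(1) by auto
    have "x \<in> cube n" "x \<noteq> ?z" using x s(2) by (auto simp: weight_words_iff_dist_zero)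
    moreover have "hverts ?H = cube n" by (simp add: triangle_hypergraph_def)
    ultimately show ?thesis using triangle[OF x y]
      by (auto simp: G_def hyp_link_def Let_def)
  qed
  ultimately show verts: "hverts G = weight_words n s" by blast
  fix x y assume x: "x \<in> weight_words n s" and y: "y \<in> weight_words n s"
  have "{x, y} \<in> hedges G \<longleftrightarrow> {x, y} \<subseteq> hverts G \<and> {x, y} \<union> {?z} \<in> hedges ?H"
    by (simp add: G_def hyp_link_def Let_def)
  also have "\<dots> \<longleftrightarrow> {?z, x, y} \<in> hedges ?H"
    using verts x y by (simp add: insert_commute)
  also have "\<dots> \<longleftrightarrow> hamming_dist x y = s"
  proof
    assume e: "{?z, x, y} \<in> hedges ?H"
    then have "x \<noteq> y" by (auto simp: triangle_hypergraph_def card_insert_if split: if_splits)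
    with e show "hamming_dist x y = s" by (auto simp: triangle_hypergraph_def)
  qed (use triangle x y in blast)
  finally show "{x, y} \<in> hedges G \<longleftrightarrow> hamming_dist x y = s" .
qed

lemma kernel_graph_weight_words:
  assumes s: "even s" "0 < s" "s \<le> n" "s div 2 \<le> n - s"
  shows "kernel_graph (weight_words n s) (min s (n - s))
    (\<lambda>k x y. hahn n s k (real (card (support x - support y))))
    (\<lambda>x y. hamming_dist x y = s) (\<lambda>k. hahn n s k (real s / 2))"
proof
  let ?W = "weight_words n s" and ?m = "min s (n - s)"
  let ?d = "\<lambda>x y. card (support x - support y)"
  have span: "\<exists>b. \<forall>x\<in>?W. \<forall>y\<in>?W. g (?d x y) = (\<Sum>k\<le>?m. b k * hahn n s k (real (?d x y)))"
    for g :: "nat \<Rightarrow> real"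
  proof -
    obtain b where "\<And>t. t \<le> ?m \<Longrightarrow> g t = (\<Sum>k\<le>?m. b k * hahn n s k (real t))"
      using hahn_expansion[of s n ?m g] s(3) by auto
    moreover have "?d x y \<le> ?m" if "x \<in> ?W" "y \<in> ?W" for x y
      using level_card(5,6)[OF support_in_level support_in_level, OF that] by simp
    ultimately show ?thesis by blast
  qed
  have half: "hamming_dist x y = s \<longleftrightarrow> ?d x y = s div 2" if "x \<in> ?W" "y \<in> ?W" for x y
    using hamming_dist_weight_words[OF that] s(1) by auto
  have eq: "x = y \<longleftrightarrow> ?d x y = 0" if "x \<in> ?W" "y \<in> ?W" for x y
  proof -
    have "?d y x = ?d x y" by (rule level_card(4)[OF support_in_level support_in_level, OF that])
    moreover have "?d x y = 0 \<longleftrightarrow> support x \<subseteq> support y" "?d y x = 0 \<longleftrightarrow> support y \<subseteq> support x"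
      by simp_all
    ultimately have "?d x y = 0 \<longleftrightarrow> support x = support y" by (metis subset_antisym subset_refl)
    also have "\<dots> \<longleftrightarrow> x = y"
      using bij_betw_support[of n s] that by (auto simp: bij_betw_def inj_on_def)
    finally show ?thesis by (rule sym)
  qed
  show "finite ?W"
    using bij_betw_finite[OF bij_betw_support] finite_level by blast
  have "{..<s} \<in> level n s" using s(3) by (auto simp: level_def)
  then show "?W \<noteq> {}" using bij_betw_support[of n s] by (auto simp: bij_betw_def)
  show "hahn n s k (real (?d x y)) = hahn n s k (real (?d y x))" if "x \<in> ?W" "y \<in> ?W" for k x y
    using level_card(4)[OF support_in_level support_in_level, OF that] by simp
  show "hahn n s k (real (?d x x)) = 1" for k x by simp
  show "hahn n s 0 (real (?d x y)) = 1" for x y by simp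
  show "(\<Sum>z\<in>?W. hahn n s j (real (?d x z)) * hahn n s k (real (?d z y))) = 0"
    if "j \<le> ?m" "k \<le> ?m" "j \<noteq> k" "x \<in> ?W" "y \<in> ?W" for j k x y
  proof -
    have "(\<Sum>z\<in>?W. hahn n s j (real (?d x z)) * hahn n s k (real (?d z y)))
        = (\<Sum>Z\<in>level n s. hahn n s j (real (card (support x - Z))) * hahn n s k (real (card (Z - support y))))"
      by (rule sum.reindex_bij_betw[OF bij_betw_support])
    also have "\<dots> = 0"
      using that support_in_level by (intro hahn_kernels_orthogonal) auto
    finally show ?thesis .
  qed
  show "\<exists>w. \<forall>x\<in>?W. \<forall>y\<in>?W. of_bool (x = y) = (\<Sum>k\<le>?m. w k * hahn n s k (real (?d x y)))"
    using span[of "\<lambda>t. of_bool (t = 0)"] eq by simp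
  show "\<exists>b. \<forall>x\<in>?W. \<forall>y\<in>?W. of_bool (hamming_dist x y = s) = (\<Sum>k\<le>?m. b k * hahn n s k (real (?d x y)))"
    using span[of "\<lambda>t. of_bool (t = s div 2)"] half by simp
  show "hahn n s k (real (?d x y)) = hahn n s k (real s / 2)"
    if "x \<in> ?W" "y \<in> ?W" "hamming_dist x y = s" for k x y
    using half[OF that(1,2)] that(3) s(1) by (auto elim!: evenE)
  show "hamming_dist x x \<noteq> s" for x using s(2) by simp
  show "\<exists>y\<in>?W. hamming_dist x y = s" if "x \<in> ?W" for x
    using weight_word_at_distance[OF that, of "s div 2"] s by simp
qed

theorem theorem7p2:
  fixes n s :: nat
  assumes "n \<ge> 1" and "even s" and "0 < s" and "s \<le> 2 * n div 3"
  shows "theta_number 2 (hyp_link (triangle_hypergraph n s) (zero_word n)) =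
           real (card (weight_words n s)) * (M_Q n s / (M_Q n s - 1))"
proof -
  have s: "even s" "0 < s" "s \<le> n" "s div 2 \<le> n - s" using assms by auto
  define G where "G = hyp_link (triangle_hypergraph n s) (zero_word n)"
  let ?W = "weight_words n s"
  note verts = hverts_zero_link[OF s(1,2,4), folded G_def]
  note edges = hedges_zero_link[OF s(1,2,4), folded G_def]
  interpret kernel_graph ?W "min s (n - s)"
    "\<lambda>k x y. hahn n s k (real (card (support x - support y)))"
    "\<lambda>x y. hamming_dist x y = s" "\<lambda>k. hahn n s k (real s / 2)"
    by (rule kernel_graph_weight_words[OF s])
  have M: "M_Q n s = min_q"
    unfolding M_Q_def min_q_def by (rule arg_cong[of _ _ Min]) auto
  have "uniform 2 G"
    unfolding G_def using uniform_triangle_hypergraph[of n s]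
    by (intro uniform_hyp_link) (simp add: numeral_3_eq_3 numeral_2_eq_2)
  note body = theta_body_graph[OF this, unfolded verts]
  show ?thesis
    unfolding theta_number_def G_def[symmetric] verts M
  proof (rule Greatest_equality)
    obtain F where F: "psd_on (insert None (Some ` ?W)) (bordered F)"
      "\<And>x y. \<lbrakk>x \<in> ?W; y \<in> ?W; hamming_dist x y = s\<rbrakk> \<Longrightarrow> F x y = 0"
      "\<And>x. x \<in> ?W \<Longrightarrow> F x x = min_q / (min_q - 1)"
      by (rule trace_bound_attained) blast
    have "(\<lambda>x\<in>?W. F x x) \<in> theta_body 2 G"
      unfolding body using F(1,2) edges by (auto intro!: exI[of _ F])
    moreover have "real (card ?W) * (min_q / (min_q - 1)) = (\<Sum>x\<in>?W. (\<lambda>x\<in>?W. F x x) x)"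
      using F(3) by simp
    ultimately show "\<exists>f\<in>theta_body 2 G. real (card ?W) * (min_q / (min_q - 1)) = (\<Sum>x\<in>?W. f x)"
      by blast
  next
    fix t assume "\<exists>f\<in>theta_body 2 G. t = (\<Sum>x\<in>?W. f x)"
    then obtain f F where "t = (\<Sum>x\<in>?W. f x)" "\<forall>x\<in>?W. f x = F x x"
      and F: "psd_on (insert None (Some ` ?W)) (bordered F)"
        "\<forall>x\<in>?W. \<forall>y\<in>?W. {x, y} \<in> hedges G \<longrightarrow> F x y = 0"
      unfolding body by blast
    then have "t = (\<Sum>x\<in>?W. F x x)" by simp
    also have "\<dots> \<le> real (card ?W) * (min_q / (min_q - 1))"
      using F edges by (intro trace_upper_bound) auto
    finally show "t \<le> real (card ?W) * (min_q / (min_q - 1))" .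
  qed
qed

end
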